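(* Let $\mathcal{H}$ and $\mathcal{K}$ be complex Hilbert spaces, let $T\in\mathcal{B}(\mathcal{H})$ have closed range, let $B\in\mathcal{B}(\mathcal{K},\mathcal{H})$ be injective with closed range, let $C\in\mathcal{B}(\mathcal{H},\mathcal{K})$ be surjective, and suppose $T=BC$. Then the following are equivalent: (1) $T$ is EP. (2) $BB^{\dag}=C^{\dag}C$. (3) $\mathcal{N}(B^* )=\mathcal{N}(C)$.
   Context: $\mathcal{B}(\mathcal{H},\mathcal{K})$ denotes the bounded linear operators from $\mathcal{H}$ to $\mathcal{K}$, and $\mathcal{B}(\mathcal{H})=\mathcal{B}(\mathcal{H},\mathcal{H})$. $\mathcal{N}(T)$ is the kernel of $T$ and $T^*$ its adjoint. An operator $T\in\mathcal{B}(\mathcal{H})$ with closed range is called EP if $\mathcal{N}(T)=\mathcal{N}(T^* )$. The Moore-Penrose inverse of an operator $S\in\mathcal{B}(\mathcal{H},\mathcal{K})$ with closed range is the unique $S^{\dag}\in\mathcal{B}(\mathcal{K},\mathcal{H})$ satisfying $SS^{\dag}S=S$, $S^{\dag}SS^{\dag}=S^{\dag}$, $(SS^{\dag})^*=SS^{\dag}$ and $(S^{\dag}S)^*=S^{\dag}S$. *)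

theory Defs
  imports "HOL-Analysis.Analysis"
begin

text \<open>
  The distribution has no complex Hilbert spaces, so they are introduced here as type classes.
  A complex space extends the library's real one by restriction of scalars, so that norm,
  topology and completeness are the library's own.
\<close>

class complex_vector = real_vector +
  fixes scaleC :: "complex \<Rightarrow> 'a \<Rightarrow> 'a" (infixr "*\<^sub>C" 75)
  assumes scaleC_of_real: "complex_of_real r *\<^sub>C x = r *\<^sub>R x"
    and scaleC_add_right: "a *\<^sub>C (x + y) = a *\<^sub>C x + a *\<^sub>C y"
    and scaleC_add_left: "(a + b) *\<^sub>C x = a *\<^sub>C x + b *\<^sub>C x"
    and scaleC_scaleC: "a *\<^sub>C (b *\<^sub>C x) = (a * b) *\<^sub>C x"
    and scaleC_one: "1 *\<^sub>C x = x"

text \<open>The inner product is linear in the second argument and antilinear in the first.\<close>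

class complex_inner = complex_vector + real_normed_vector +
  fixes cinner :: "'a \<Rightarrow> 'a \<Rightarrow> complex"
  assumes cinner_commute: "cinner x y = cnj (cinner y x)"
    and cinner_add_right: "cinner x (y + z) = cinner x y + cinner x z"
    and cinner_scaleC_right: "cinner x (a *\<^sub>C y) = a * cinner x y"
    and cinner_self_norm: "cinner x x = complex_of_real ((norm x)\<^sup>2)"

class complex_hilbert_space = complex_inner + complete_space

definition bounded_clinear ::
    "('a::complex_hilbert_space \<Rightarrow> 'b::complex_hilbert_space) \<Rightarrow> bool" where
  "bounded_clinear S \<longleftrightarrow> bounded_linear S \<and> (\<forall>a x. S (a *\<^sub>C x) = a *\<^sub>C S x)"

definition kernel :: "('a \<Rightarrow> 'b::zero) \<Rightarrow> 'a set" where
  "kernel S = {x. S x = 0}"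

definition cadjoint ::
    "('a::complex_hilbert_space \<Rightarrow> 'b::complex_hilbert_space) \<Rightarrow> 'b \<Rightarrow> 'a" where
  "cadjoint S = (THE R. bounded_clinear R \<and> (\<forall>x y. cinner (S x) y = cinner x (R y)))"

definition EP :: "('a::complex_hilbert_space \<Rightarrow> 'a) \<Rightarrow> bool" where
  "EP T \<longleftrightarrow> bounded_clinear T \<and> closed (range T) \<and> kernel T = kernel (cadjoint T)"

text \<open>
  As definite descriptions, \<open>cadjoint\<close> and \<open>mp_inverse\<close> are meaningful only where the operator
  they describe exists: for bounded operators, respectively bounded operators with closed range.
\<close>

definition is_mp_inverse ::
    "('a::complex_hilbert_space \<Rightarrow> 'b::complex_hilbert_space) \<Rightarrow> ('b \<Rightarrow> 'a) \<Rightarrow> bool" where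
  "is_mp_inverse S X \<longleftrightarrow> bounded_clinear X \<and>
     S \<circ> X \<circ> S = S \<and> X \<circ> S \<circ> X = X \<and>
     cadjoint (S \<circ> X) = S \<circ> X \<and> cadjoint (X \<circ> S) = X \<circ> S"

definition mp_inverse ::
    "('a::complex_hilbert_space \<Rightarrow> 'b::complex_hilbert_space) \<Rightarrow> 'b \<Rightarrow> 'a" where
  "mp_inverse S = (THE X. is_mp_inverse S X)"

end

theory Submission
  imports Defs
begin

text \<open>
  All three conditions say that one and the same orthogonal decomposition of the space is in play.
  Since \<open>B\<close> is injective, \<open>T = B \<circ> C\<close> has the kernel of \<open>C\<close>; since \<open>C\<close> is surjective, \<open>T\<close> has the
  range of \<open>B\<close>, so \<open>T\<close> and \<open>B\<close> have adjoints with the same kernel, namely the orthogonal complement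
  of that range (\<open>kernel_cadjoint\<close>). Hence \<open>T\<close> is EP iff the adjoint of \<open>B\<close> and \<open>C\<close> have the same
  kernel. On the other hand \<open>B \<circ> mp_inverse B\<close> and \<open>mp_inverse C \<circ> C\<close> are self-adjoint idempotents
  whose kernels are those of the adjoint of \<open>B\<close> and of \<open>C\<close> (\<open>kernel_comp_mp_inverse\<close>), and a
  self-adjoint idempotent is determined by its kernel (\<open>selfadjoint_idempotent_eq\<close>).

  The analytic content lies in the existence of adjoints and of Moore-Penrose inverses. Adjoints come
  from orthogonal decomposition along closed subspaces and the Riesz representation theorem. The
  Moore-Penrose inverse of \<open>S\<close> sends \<open>y\<close> to the least-squares solution of \<open>S x = y\<close> of minimal norm;
  its boundedness is the estimate \<open>norm x \<le> c * norm (S x)\<close> on the orthogonal complement of the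
  kernel of \<open>S\<close> (\<open>bounded_below_on_kernel_complement\<close>). That estimate is derived from the Baire
  category theorem: the vectors of the range of \<open>S\<close> that the adjoint maps into the unit ball form a
  weakly bounded set, which is therefore bounded, so the adjoint is bounded below on the range;
  duality carries the bound over to \<open>S\<close>.
\<close>

section \<open>Complex inner product spaces\<close>

lemma scaleC_zero_right: "a *\<^sub>C (0::'a::complex_vector) = 0"
  using scaleC_add_right[of a 0 0] by simp

lemma scaleC_minus_right: "a *\<^sub>C (- x) = - (a *\<^sub>C (x::'a::complex_vector))"
  using scaleC_add_right[of a x "- x"] by (simp add: scaleC_zero_right eq_neg_iff_add_eq_0 add.commute)

lemma scaleC_diff_right: "a *\<^sub>C (x - y) = a *\<^sub>C x - a *\<^sub>C (y::'a::complex_vector)"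
  using scaleC_add_right[of a x "- y"] by (simp add: scaleC_minus_right)

lemma cinner_add_left: "cinner (x + y) z = cinner x z + cinner y (z::'a::complex_inner)"
  by (metis cinner_commute cinner_add_right complex_cnj_add)

lemma cinner_scaleC_left: "cinner (a *\<^sub>C x) y = cnj a * cinner x (y::'a::complex_inner)"
  by (metis cinner_commute cinner_scaleC_right complex_cnj_mult)

lemma cinner_scaleR_right: "cinner x (r *\<^sub>R y) = of_real r * cinner x (y::'a::complex_inner)"
  by (metis scaleC_of_real cinner_scaleC_right)

lemma cinner_zero_right [simp]: "cinner x (0::'a::complex_inner) = 0"
  using cinner_add_right[of x 0 0] by simp

lemma cinner_zero_left [simp]: "cinner (0::'a::complex_inner) x = 0"
  using cinner_add_left[of 0 0 x] by simp

lemma cinner_minus_right: "cinner x (- y) = - cinner x (y::'a::complex_inner)"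
  using cinner_add_right[of x y "- y"] by (simp add: eq_neg_iff_add_eq_0 add.commute)

lemma cinner_minus_left: "cinner (- x) y = - cinner x (y::'a::complex_inner)"
  using cinner_add_left[of x "- x" y] by (simp add: eq_neg_iff_add_eq_0 add.commute)

lemma cinner_diff_right: "cinner x (y - z) = cinner x y - cinner x (z::'a::complex_inner)"
  using cinner_add_right[of x y "- z"] by (simp add: cinner_minus_right)

lemma cinner_diff_left: "cinner (x - y) z = cinner x z - cinner y (z::'a::complex_inner)"
  using cinner_add_left[of x "- y" z] by (simp add: cinner_minus_left)

lemma cinner_self_eq_0_iff [simp]: "cinner x x = 0 \<longleftrightarrow> x = (0::'a::complex_inner)"
  by (simp add: cinner_self_norm)

lemma cinner_ext: "(\<And>x. cinner x y = cinner x z) \<Longrightarrow> y = (z::'a::complex_inner)"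
  by (metis cinner_diff_right cinner_self_eq_0_iff eq_iff_diff_eq_0)

lemma cinner_eq_0_commute: "cinner x y = 0 \<longleftrightarrow> cinner y (x::'a::complex_inner) = 0"
  by (metis cinner_commute complex_cnj_zero)

lemma norm_add_square:
  "(norm (x + y))\<^sup>2 = (norm x)\<^sup>2 + 2 * Re (cinner x y) + (norm (y::'a::complex_inner))\<^sup>2"
proof -
  have "complex_of_real ((norm (x + y))\<^sup>2) = cinner x x + cinner x y + cinner y x + cinner y y"
    by (simp only: cinner_self_norm[symmetric] cinner_add_left cinner_add_right add_ac)
  then have "(norm (x + y))\<^sup>2 = Re (cinner x x + cinner x y + cinner y x + cinner y y)"
    by (metis Re_complex_of_real)
  moreover have "Re (cinner y x) = Re (cinner x y)"
    using cinner_commute[of y x] by simp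
  ultimately show ?thesis
    by (simp add: cinner_self_norm del: of_real_power)
qed

lemma norm_diff_square:
  "(norm (x - y))\<^sup>2 = (norm x)\<^sup>2 - 2 * Re (cinner x y) + (norm (y::'a::complex_inner))\<^sup>2"
  using norm_add_square[of x "- y"] by (simp add: cinner_minus_right)

lemma norm_scaleC: "norm (a *\<^sub>C x) = norm a * norm (x::'a::complex_inner)"
proof -
  have "complex_of_real ((norm (a *\<^sub>C x))\<^sup>2) = (cnj a * a) * cinner x x"
    by (simp only: cinner_self_norm[symmetric] cinner_scaleC_left cinner_scaleC_right mult_ac)
  also have "\<dots> = complex_of_real ((norm a)\<^sup>2 * (norm x)\<^sup>2)"
    by (simp only: cinner_self_norm complex_norm_square of_real_mult mult_ac)
  finally have "(norm (a *\<^sub>C x))\<^sup>2 = (norm a * norm x)\<^sup>2"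
    by (simp add: power_mult_distrib del: of_real_mult of_real_power)
  then show ?thesis
    by (simp add: power2_eq_iff_nonneg)
qed

text \<open>The real part of the inner product is bounded by the triangle inequality for the norm;
  multiplying one argument by a phase gives the bound on the modulus.\<close>

lemma norm_cinner_le: "norm (cinner x y) \<le> norm x * norm (y::'a::complex_inner)"
proof -
  have re: "Re (cinner x z) \<le> norm x * norm z" for z
  proof -
    have "(norm (x + z))\<^sup>2 \<le> (norm x + norm z)\<^sup>2"
      by (intro power_mono norm_triangle_ineq) simp
    then show ?thesis
      by (simp add: norm_add_square power2_sum)
  qed
  show ?thesis
  proof (cases "cinner x y = 0")
    case False
    define a where "a = cnj (sgn (cinner x y))"
    have "a * cinner x y = cinner x y * cnj (cinner x y) / complex_of_real (norm (cinner x y))"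
      by (simp add: a_def sgn_eq)
    also have "\<dots> = complex_of_real (norm (cinner x y))"
      using False by (simp add: complex_norm_square[symmetric] power2_eq_square)
    finally have "a * cinner x y = complex_of_real (norm (cinner x y))" .
    then have "norm (cinner x y) = Re (cinner x (a *\<^sub>C y))"
      by (simp add: cinner_scaleC_right)
    also have "\<dots> \<le> norm x * norm (a *\<^sub>C y)"
      by (rule re)
    also have "\<dots> = norm x * norm y"
      using False by (simp add: norm_scaleC a_def norm_sgn)
    finally show ?thesis .
  qed simp
qed

lemma bounded_linear_cinner_right: "bounded_linear (cinner (x::'a::complex_inner))"
proof (rule bounded_linear_intro)
  show "norm (cinner x y) \<le> norm y * norm x" for y
    using norm_cinner_le[of x y] by (simp add: mult.commute)
qed (simp_all add: cinner_add_right cinner_scaleR_right scaleR_conv_of_real)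

section \<open>Orthogonal decomposition\<close>

text \<open>Existence of the nearest point of a closed real subspace: by the parallelogram law a
  minimising sequence is Cauchy, and the minimiser is characterised by orthogonality with respect
  to the real part of the inner product.\<close>

lemma orthogonal_decomposition_Re:
  fixes x :: "'a::complex_hilbert_space"
  assumes "closed M" and "subspace M"
  obtains m where "m \<in> M" and "\<And>n. n \<in> M \<Longrightarrow> Re (cinner n (x - m)) = 0"
proof -
  define D where "D = (INF n\<in>M. (norm (x - n))\<^sup>2)"
  have ne: "M \<noteq> {}"
    using assms(2) subspace_0 by blast
  have bdd: "bdd_below ((\<lambda>n. (norm (x - n))\<^sup>2) ` M)"
    by (rule bdd_belowI2[of _ 0]) simp
  have D_le: "D \<le> (norm (x - n))\<^sup>2" if "n \<in> M" for n
    unfolding D_def using bdd that by (rule cINF_lower)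
  have "\<exists>n\<in>M. (norm (x - n))\<^sup>2 < D + 1 / Suc k" for k
  proof -
    have "D < D + 1 / Suc k"
      by simp
    then show ?thesis
      using cINF_less_iff[OF ne bdd, of "D + 1 / Suc k"] by (simp add: D_def)
  qed
  then obtain s where sM: "\<And>k. s k \<in> M" and s: "\<And>k. (norm (x - s k))\<^sup>2 < D + 1 / Suc k"
    by metis
  \<comment> \<open>Parallelogram law for \<open>x - s j\<close> and \<open>x - s k\<close>, whose midpoint has norm at least \<open>sqrt D\<close>.\<close>
  have dist_s: "(norm (s j - s k))\<^sup>2 \<le> 2 / Suc j + 2 / Suc k" for j k
  proof -
    let ?h = "(1/2) *\<^sub>R (s j + s k)"
    have "?h \<in> M"
      using sM assms(2) by (simp add: subspace_add subspace_scale)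
    then have "D \<le> (norm (x - ?h))\<^sup>2"
      by (rule D_le)
    moreover have "(norm (x - s j + (x - s k)))\<^sup>2 = 4 * (norm (x - ?h))\<^sup>2"
    proof -
      have "x - s j + (x - s k) = 2 *\<^sub>R (x - ?h)"
        by (simp add: algebra_simps scaleR_2)
      then show ?thesis
        by (simp add: power_mult_distrib)
    qed
    moreover have "x - s k - (x - s j) = s j - s k" "x - s k + (x - s j) = x - s j + (x - s k)"
      by simp_all
    ultimately show ?thesis
      using s[of j] s[of k] norm_add_square[of "x - s k" "x - s j"]
        norm_diff_square[of "x - s k" "x - s j"]
      by (simp only: \<open>x - s k - (x - s j) = s j - s k\<close>)
  qed
  have "Cauchy s"
  proof (rule metric_CauchyI)
    fix e :: real assume "e > 0"
    then obtain N where N: "4 / e\<^sup>2 < real N"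
      using reals_Archimedean2 by blast
    have "dist (s j) (s k) < e" if "j \<ge> N" "k \<ge> N" for j k
    proof -
      have "0 < 4 / e\<^sup>2"
        using \<open>e > 0\<close> by simp
      then have "N > 0"
        using N by linarith
      have "2 / Suc j \<le> 2 / real N" "2 / Suc k \<le> 2 / real N"
        using that \<open>N > 0\<close> by (simp_all add: frac_le)
      then have "(norm (s j - s k))\<^sup>2 \<le> 4 / real N"
        using dist_s[of j k] by linarith
      also have "\<dots> < e\<^sup>2"
        using N \<open>e > 0\<close> \<open>N > 0\<close> by (simp add: field_simps)
      finally show ?thesis
        using \<open>e > 0\<close> by (simp add: dist_norm power_less_imp_less_base)
    qed
    then show "\<exists>N. \<forall>j\<ge>N. \<forall>k\<ge>N. dist (s j) (s k) < e"
      by blast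
  qed
  then obtain m where lim: "s \<longlonglongrightarrow> m"
    using Cauchy_convergent_iff convergent_def by blast
  have mM: "m \<in> M"
    using assms(1) sM lim by (rule closed_sequentially)
  have "(\<lambda>k. (norm (x - s k))\<^sup>2) \<longlonglongrightarrow> (norm (x - m))\<^sup>2"
    by (intro tendsto_intros lim)
  moreover have "(\<lambda>k. D + 1 / Suc k) \<longlonglongrightarrow> D + 0"
    by (intro tendsto_intros LIMSEQ_Suc lim_1_over_n)
  ultimately have "(norm (x - m))\<^sup>2 \<le> D + 0"
    by (rule LIMSEQ_le) (blast intro: less_imp_le s)
  then have m_le: "(norm (x - m))\<^sup>2 \<le> D"
    by simp
  have "Re (cinner n (x - m)) = 0" if "n \<in> M" for n
  proof (cases "n = 0")
    case False
    define r where "r = Re (cinner (x - m) n)"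
    \<comment> \<open>The minimum over \<open>t\<close> of the squared distance from \<open>x\<close> to \<open>m + t *\<^sub>R n\<close> is attained here.\<close>
    define t where "t = r / (norm n)\<^sup>2"
    have "m + t *\<^sub>R n \<in> M"
      using mM that assms(2) by (simp add: subspace_add subspace_scale)
    then have "(norm (x - m))\<^sup>2 \<le> (norm (x - m - t *\<^sub>R n))\<^sup>2"
      unfolding diff_diff_eq using D_le m_le order_trans by blast
    also have "\<dots> = (norm (x - m))\<^sup>2 - 2 * t * r + t\<^sup>2 * (norm n)\<^sup>2"
      unfolding norm_diff_square[of "x - m" "t *\<^sub>R n"]
      by (simp add: r_def cinner_scaleR_right power_mult_distrib)
    also have "\<dots> = (norm (x - m))\<^sup>2 - r\<^sup>2 / (norm n)\<^sup>2"
      using False by (simp add: t_def field_simps power2_eq_square)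
    finally have "r\<^sup>2 / (norm n)\<^sup>2 \<le> 0"
      by simp
    then have "r = 0"
      using False by (simp add: divide_le_0_iff)
    then show ?thesis
      using cinner_commute[of n "x - m"] by (simp add: r_def)
  qed simp
  with mM show ?thesis
    by (rule that)
qed

text \<open>For a complex subspace, orthogonality of the real parts against \<open>n\<close> and \<open>\<i> *\<^sub>C n\<close> gives
  orthogonality with respect to the full inner product.\<close>

lemma orthogonal_decomposition:
  fixes x :: "'a::complex_hilbert_space"
  assumes "closed M" and "subspace M" and scaleC: "\<And>a n. n \<in> M \<Longrightarrow> a *\<^sub>C n \<in> M"
  obtains m where "m \<in> M" and "\<And>n. n \<in> M \<Longrightarrow> cinner n (x - m) = 0"
proof -
  obtain m where m: "m \<in> M" "\<And>n. n \<in> M \<Longrightarrow> Re (cinner n (x - m)) = 0"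
    using orthogonal_decomposition_Re[OF assms(1,2)] by metis
  have "cinner n (x - m) = 0" if "n \<in> M" for n
    using m(2)[OF that] m(2)[OF scaleC[OF that, of \<i>]]
    by (simp add: cinner_scaleC_left complex_eq_iff)
  with m(1) show ?thesis
    by (rule that)
qed

section \<open>Adjoints\<close>

lemma bounded_clinear_bounded_linear: "bounded_clinear S \<Longrightarrow> bounded_linear S"
  by (simp add: bounded_clinear_def)

lemma bounded_clinear_scaleC: "bounded_clinear S \<Longrightarrow> S (a *\<^sub>C x) = a *\<^sub>C S x"
  by (simp add: bounded_clinear_def)

lemma bounded_clinear_linear: "bounded_clinear S \<Longrightarrow> linear S"
  by (simp add: bounded_clinear_def bounded_linear.linear)

lemma bounded_clinear_add: "bounded_clinear S \<Longrightarrow> S (x + y) = S x + S y"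
  by (simp add: bounded_clinear_linear linear_add)

lemma bounded_clinear_diff: "bounded_clinear S \<Longrightarrow> S (x - y) = S x - S y"
  by (simp add: bounded_clinear_linear linear_diff)

lemma bounded_clinear_0: "bounded_clinear S \<Longrightarrow> S 0 = 0"
  by (simp add: bounded_clinear_linear linear_0)

lemma bounded_clinear_compose:
  "bounded_clinear S \<Longrightarrow> bounded_clinear R \<Longrightarrow> bounded_clinear (S \<circ> R)"
  by (simp add: bounded_clinear_def bounded_linear_compose comp_def)

lemma bounded_clinearI:
  assumes "\<And>x y. S (x + y) = S x + S y" and scaleC: "\<And>a x. S (a *\<^sub>C x) = a *\<^sub>C S x"
    and "\<And>x. norm (S x) \<le> norm x * K"
  shows "bounded_clinear S"
  unfolding bounded_clinear_def
proof
  show "bounded_linear S"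
    using assms(1,3) scaleC[of "of_real _"] unfolding scaleC_of_real
    by (intro bounded_linear_intro)
qed (simp add: scaleC)

text \<open>Here \<open>f\<close> takes values in the scalars, so complex linearity is stated with multiplication.\<close>

lemma riesz_representation:
  fixes f :: "'a::complex_hilbert_space \<Rightarrow> complex"
  assumes "bounded_linear f" and scaleC: "\<And>a x. f (a *\<^sub>C x) = a * f x"
  obtains u where "\<And>x. f x = cinner u x"
proof (cases "\<forall>x. f x = 0")
  case True
  then show ?thesis
    using that[of 0] by simp
next
  case False
  then obtain z where z: "f z \<noteq> 0"
    by blast
  interpret f: bounded_linear f
    by fact
  have "closed {x. f x = 0}"
    by (intro closed_Collect_eq f.continuous_on continuous_intros)
  moreover have "subspace {x. f x = 0}"
    by (auto simp: subspace_def f.zero f.add f.scaleR)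
  moreover have "a *\<^sub>C n \<in> {x. f x = 0}" if "n \<in> {x. f x = 0}" for a n
    using that by (simp add: scaleC)
  ultimately obtain m where "m \<in> {x. f x = 0}"
    and "\<And>n. n \<in> {x. f x = 0} \<Longrightarrow> cinner n (z - m) = 0"
    using orthogonal_decomposition[of "{x. f x = 0}" z] by blast
  then have m: "f m = 0" and orth: "\<And>n. f n = 0 \<Longrightarrow> cinner n (z - m) = 0"
    by simp_all
  \<comment> \<open>The functional is a multiple of the inner product with a vector orthogonal to its kernel.\<close>
  define e where "e = z - m"
  have fe: "f e \<noteq> 0"
    using z m by (simp add: e_def f.diff)
  then have "e \<noteq> 0"
    using f.zero by auto
  have "f x = cinner (cnj (f e / cinner e e) *\<^sub>C e) x" for x
  proof -
    have "f (f e *\<^sub>C x - f x *\<^sub>C e) = 0"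
      by (simp add: f.diff scaleC)
    then have "cinner (f e *\<^sub>C x - f x *\<^sub>C e) e = 0"
      using orth by (simp only: e_def)
    then have "cinner e (f e *\<^sub>C x - f x *\<^sub>C e) = 0"
      by (rule cinner_eq_0_commute[THEN iffD1])
    then have "f e * cinner e x = f x * cinner e e"
      by (simp add: cinner_diff_right cinner_scaleC_right)
    with \<open>e \<noteq> 0\<close> show ?thesis
      by (simp add: cinner_scaleC_left field_simps)
  qed
  then show ?thesis
    by (rule that)
qed

lemma cadjoint_exists:
  assumes S: "bounded_clinear S"
  shows "\<exists>R. bounded_clinear R \<and> (\<forall>x y. cinner (S x) y = cinner x (R y))"
proof -
  note bl = bounded_clinear_bounded_linear[OF S]
  have "\<exists>u. \<forall>x. cinner y (S x) = cinner u x" for y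
  proof -
    have "bounded_linear (\<lambda>x. cinner y (S x))"
      by (rule bounded_linear_compose[OF bounded_linear_cinner_right bl])
    moreover have "cinner y (S (a *\<^sub>C x)) = a * cinner y (S x)" for a x
      by (simp add: bounded_clinear_scaleC[OF S] cinner_scaleC_right)
    ultimately show ?thesis
      using riesz_representation[of "\<lambda>x. cinner y (S x)"] by blast
  qed
  then obtain R where R: "\<And>x y. cinner y (S x) = cinner (R y) x"
    by metis
  have adj: "cinner (S x) y = cinner x (R y)" for x y
    using R[of y x] cinner_commute[of "S x" y] cinner_commute[of x "R y"] by simp
  obtain K where K: "\<And>x. norm (S x) \<le> norm x * K" and "K \<ge> 0"
    using bounded_linear.nonneg_bounded[OF bl] by blast
  have "bounded_clinear R"
  proof (rule bounded_clinearI)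
    show "R (y + z) = R y + R z" for y z
      by (rule cinner_ext) (simp add: adj[symmetric] cinner_add_right)
    show "R (a *\<^sub>C y) = a *\<^sub>C R y" for a y
      by (rule cinner_ext) (simp add: adj[symmetric] cinner_scaleC_right)
    show "norm (R y) \<le> norm y * K" for y
    proof (cases "R y = 0")
      case False
      have "(norm (R y))\<^sup>2 = norm (cinner (S (R y)) y)"
        by (simp add: adj cinner_self_norm norm_power)
      also have "\<dots> \<le> norm (S (R y)) * norm y"
        by (rule norm_cinner_le)
      also have "\<dots> \<le> norm (R y) * K * norm y"
        by (rule mult_right_mono[OF K]) simp
      finally show ?thesis
        using False by (simp add: power2_eq_square mult_ac)
    qed (simp add: \<open>K \<ge> 0\<close>)
  qed
  with adj show ?thesis
    by blast
qed

lemma cadjoint_eqI: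
  assumes "bounded_clinear R" and "\<And>x y. cinner (S x) y = cinner x (R y)"
  shows "cadjoint S = R"
  unfolding cadjoint_def
proof (rule the_equality)
  fix R' assume R': "bounded_clinear R' \<and> (\<forall>x y. cinner (S x) y = cinner x (R' y))"
  show "R' = R"
  proof
    show "R' y = R y" for y
      by (rule cinner_ext) (metis R' assms(2))
  qed
qed (use assms in blast)

lemma
  assumes "bounded_clinear S"
  shows bounded_clinear_cadjoint: "bounded_clinear (cadjoint S)"
    and cinner_cadjoint: "cinner (S x) y = cinner x (cadjoint S y)"
  using cadjoint_exists[OF assms] cadjoint_eqI[of _ S] by metis+

lemma cinner_cadjoint_left:
  "bounded_clinear S \<Longrightarrow> cinner (cadjoint S y) x = cinner y (S x)"
  using cinner_cadjoint[of S x y] cinner_commute[of y "S x"] cinner_commute[of "cadjoint S y" x]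
  by simp

lemma kernel_cadjoint:
  assumes "bounded_clinear S"
  shows "kernel (cadjoint S) = {y. \<forall>z\<in>range S. cinner z y = 0}"
proof -
  have "cadjoint S y = 0 \<longleftrightarrow> (\<forall>x. cinner (S x) y = 0)" for y
    by (metis cinner_cadjoint[OF assms] cinner_self_eq_0_iff cinner_zero_right)
  then show ?thesis
    by (simp add: kernel_def)
qed

lemma range_decomposition:
  assumes S: "bounded_clinear S" and "closed (range S)"
  obtains x where "\<And>z. cinner (S z) (y - S x) = 0"
proof -
  have "subspace (range S)"
    using linear_subspace_image[OF bounded_clinear_linear[OF S] subspace_UNIV] .
  moreover have "a *\<^sub>C n \<in> range S" if "n \<in> range S" for a n
    using that bounded_clinear_scaleC[OF S] by (metis rangeE rangeI)
  ultimately obtain m where "m \<in> range S" "\<And>n. n \<in> range S \<Longrightarrow> cinner n (y - m) = 0"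
    using orthogonal_decomposition[of "range S" y] assms(2) by blast
  then show ?thesis
    using that by blast
qed

lemma kernel_decomposition:
  assumes S: "bounded_clinear S"
  obtains n where "S n = 0" and "\<And>z. S z = 0 \<Longrightarrow> cinner z (x - n) = 0"
proof -
  note bl = bounded_clinear_bounded_linear[OF S]
  have "closed {z. S z = 0}"
    by (rule closed_Collect_eq[OF linear_continuous_on[OF bl] continuous_on_const])
  moreover have "subspace {z. S z = 0}"
    using bounded_clinear_linear[OF S]
    by (simp add: subspace_def linear_0 linear_add linear_scale)
  moreover have "a *\<^sub>C n \<in> {z. S z = 0}" if "n \<in> {z. S z = 0}" for a n
    using that by (simp add: bounded_clinear_scaleC[OF S] scaleC_zero_right)
  ultimately obtain n where "n \<in> {z. S z = 0}"
    and "\<And>z. z \<in> {z. S z = 0} \<Longrightarrow> cinner z (x - n) = 0"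
    using orthogonal_decomposition[of "{z. S z = 0}" x] by blast
  then show ?thesis
    using that by simp
qed

section \<open>Operators with closed range\<close>

text \<open>The uniform boundedness principle for the functionals given by the vectors of \<open>W\<close>. By Baire, one
  of the closed sets on which all of them are bounded by \<open>k\<close> contains a ball.\<close>

lemma weakly_bounded_imp_bounded:
  fixes W :: "'a::complex_hilbert_space set"
  assumes "\<And>v. \<exists>c. \<forall>w\<in>W. norm (cinner w v) \<le> c"
  shows "\<exists>c. \<forall>w\<in>W. norm w \<le> c"
proof -
  define F where "F k = {v. \<forall>w\<in>W. norm (cinner w v) \<le> real k}" for k
  have closedF: "closed (F k)" for k
  proof -
    have "F k = (\<Inter>w\<in>W. {v. norm (cinner w v) \<le> real k})"
      by (auto simp: F_def)
    moreover have "closed {v. norm (cinner w v) \<le> real k}" for w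
      by (intro closed_Collect_le continuous_intros
          bounded_linear.continuous_on[OF bounded_linear_cinner_right])
    ultimately show ?thesis
      by auto
  qed
  have "v \<in> (\<Union>k. F k)" for v
  proof -
    obtain c where "\<forall>w\<in>W. norm (cinner w v) \<le> c"
      using assms by blast
    moreover obtain k where "c \<le> real k"
      using real_arch_simple by blast
    ultimately show ?thesis
      unfolding F_def by (blast intro: order_trans)
  qed
  then have "(\<Union>k. F k) = UNIV"
    by (rule UNIV_eq_I[symmetric])
  have "\<exists>k. interior (F k) \<noteq> {}"
  proof (rule ccontr)
    assume "\<not> ?thesis"
    then have "closedin euclidean A \<and> euclidean interior_of A = {}" if "A \<in> range F" for A
      using that closedF by auto
    then have "euclidean interior_of (\<Union>k. F k) = {}"
      by (intro Baire_category_alt) (simp_all add: completely_metrizable_space_euclidean)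
    then show False
      by (simp add: \<open>(\<Union>k. F k) = UNIV\<close>)
  qed
  then obtain k v where "v \<in> interior (F k)"
    by blast
  then obtain r where "r > 0" and ball: "ball v r \<subseteq> F k"
    unfolding mem_interior by blast
  have "norm w \<le> 4 * real k / r" if "w \<in> W" for w
  proof (cases "w = 0")
    case False
    define u where "u = (r / (2 * norm w)) *\<^sub>R w"
    have "norm u = r / 2"
      using False \<open>r > 0\<close> by (simp add: u_def)
    then have "v \<in> F k" "v + u \<in> F k"
      using \<open>r > 0\<close> ball by (auto simp: dist_norm)
    then have "norm (cinner w v) \<le> k" "norm (cinner w v + cinner w u) \<le> k"
      using that by (auto simp: F_def cinner_add_right)
    then have "norm (cinner w u) \<le> 2 * k"
      using norm_triangle_ineq4[of "cinner w v + cinner w u" "cinner w v"] by simp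
    moreover have "norm (cinner w u) = r / 2 * norm w"
      using False \<open>r > 0\<close>
      by (simp add: u_def cinner_scaleR_right cinner_self_norm norm_mult norm_power power2_eq_square)
    ultimately show ?thesis
      using \<open>r > 0\<close> by (simp add: field_simps)
  qed (use \<open>r > 0\<close> in simp)
  then show ?thesis
    by blast
qed

text \<open>If \<open>w\<close> lies in the range of \<open>S\<close> and the adjoint maps it into the unit ball, then its inner product
  with \<open>S x\<close> is bounded by \<open>norm x\<close>, and so its inner product with \<open>v\<close> is bounded by the norm of any \<open>x\<close>
  for which \<open>S x\<close> is the projection of \<open>v\<close> to the range. Thus such \<open>w\<close> form a weakly bounded set.\<close>

lemma cadjoint_bounded_below_on_range:
  assumes S: "bounded_clinear S" and "closed (range S)"
  shows "\<exists>c\<ge>0. \<forall>w\<in>range S. norm w \<le> c * norm (cadjoint S w)"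
proof -
  let ?R = "cadjoint S"
  note R = bounded_clinear_cadjoint[OF S]
  define W where "W = {w \<in> range S. norm (?R w) \<le> 1}"
  have "\<exists>c. \<forall>w\<in>W. norm (cinner w v) \<le> c" for v
  proof -
    obtain x where x: "\<And>z. cinner (S z) (v - S x) = 0"
      using range_decomposition[OF assms] by blast
    have "norm (cinner w v) \<le> norm x" if "w \<in> W" for w
    proof -
      have "cinner w v = cinner w (S x)"
        using x that by (auto simp: W_def cinner_diff_right)
      also have "\<dots> = cinner (?R w) x"
        by (simp add: cinner_cadjoint_left[OF S])
      finally have "norm (cinner w v) \<le> norm (?R w) * norm x"
        by (simp add: norm_cinner_le)
      also have "\<dots> \<le> 1 * norm x"
        using that by (intro mult_right_mono) (auto simp: W_def)
      finally show ?thesis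
        by simp
    qed
    then show ?thesis
      by blast
  qed
  then obtain c where c: "\<And>w. w \<in> W \<Longrightarrow> norm w \<le> c"
    using weakly_bounded_imp_bounded[of W] by blast
  have "0 \<in> W"
    using bounded_clinear_0[OF S] bounded_clinear_0[OF R] unfolding W_def
    by (metis (mono_tags, lifting) mem_Collect_eq norm_zero rangeI zero_le_one)
  then have "c \<ge> 0"
    using c by fastforce
  have "norm w \<le> c * norm (?R w)" if "w \<in> range S" for w
  proof (cases "?R w = 0")
    case True
    moreover obtain x where "w = S x"
      using \<open>w \<in> range S\<close> by blast
    ultimately have "cinner w w = 0"
      using cinner_cadjoint[OF S, of x w] by simp
    then show ?thesis
      using \<open>c \<ge> 0\<close> by simp
  next
    case False
    have "(1 / norm (?R w)) *\<^sub>R w \<in> range S"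
      using \<open>w \<in> range S\<close> linear_scale[OF bounded_clinear_linear[OF S]] by (metis rangeE rangeI)
    then have "(1 / norm (?R w)) *\<^sub>R w \<in> W"
      using False by (simp add: W_def linear_scale[OF bounded_clinear_linear[OF R]])
    then show ?thesis
      using c[of "(1 / norm (?R w)) *\<^sub>R w"] False by (simp add: field_simps)
  qed
  with \<open>c \<ge> 0\<close> show ?thesis
    by blast
qed

lemma subspace_closure:
  fixes V :: "'a::real_normed_vector set"
  assumes "subspace V"
  shows "subspace (closure V)"
  unfolding subspace_def
proof (intro conjI ballI allI)
  show "0 \<in> closure V"
    using subspace_0[OF assms] closure_subset by blast
next
  fix x y assume "x \<in> closure V" "y \<in> closure V"
  then obtain f g where "\<And>k. f k \<in> V" "f \<longlonglongrightarrow> x" "\<And>k. g k \<in> V" "g \<longlonglongrightarrow> y"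
    unfolding closure_sequential by metis
  then show "x + y \<in> closure V"
    unfolding closure_sequential
    by (intro exI[of _ "\<lambda>k. f k + g k"] conjI allI tendsto_add subspace_add[OF assms])
next
  fix c x assume "x \<in> closure V"
  then obtain f where "\<And>k. f k \<in> V" "f \<longlonglongrightarrow> x"
    unfolding closure_sequential by metis
  then show "c *\<^sub>R x \<in> closure V"
    unfolding closure_sequential
    by (intro exI[of _ "\<lambda>k. c *\<^sub>R f k"] conjI allI tendsto_intros subspace_scale[OF assms])
qed

text \<open>A vector \<open>x\<close> orthogonal to the kernel of \<open>S\<close> is a limit of vectors \<open>u\<close> in the range of the adjoint.
  Each such \<open>u\<close> is the image of some \<open>w\<close> in the range of \<open>S\<close> with \<open>norm w \<le> c * norm u\<close>, and
  \<open>cinner u x = cinner w (S x)\<close>; let \<open>u\<close> tend to \<open>x\<close>.\<close>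

lemma bounded_below_on_kernel_complement:
  assumes S: "bounded_clinear S" and "closed (range S)"
  shows "\<exists>c\<ge>0. \<forall>x. (\<forall>z. S z = 0 \<longrightarrow> cinner z x = 0) \<longrightarrow> norm x \<le> c * norm (S x)"
proof -
  let ?R = "cadjoint S"
  note R = bounded_clinear_cadjoint[OF S]
  obtain c where "c \<ge> 0" and c: "\<And>w. w \<in> range S \<Longrightarrow> norm w \<le> c * norm (?R w)"
    using cadjoint_bounded_below_on_range[OF assms] by blast
  have "norm x \<le> c * norm (S x)" if x: "\<And>z. S z = 0 \<Longrightarrow> cinner z x = 0" for x
  proof -
    let ?M = "closure (range ?R)"
    have estimate: "norm (cinner u x) \<le> c * norm u * norm (S x)" if "u \<in> range ?R" for u
    proof -
      obtain y where u: "u = ?R y"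
        using \<open>u \<in> range ?R\<close> by blast
      obtain a where a: "\<And>z. cinner (S z) (y - S a) = 0"
        using range_decomposition[OF assms] by blast
      have "?R (y - S a) = 0"
        by (rule cinner_ext) (simp add: cinner_cadjoint[OF S, symmetric] a)
      then have u': "u = ?R (S a)"
        by (simp add: u bounded_clinear_diff[OF R])
      have "norm (cinner u x) = norm (cinner (S a) (S x))"
        by (simp add: u' cinner_cadjoint_left[OF S])
      also have "\<dots> \<le> norm (S a) * norm (S x)"
        by (rule norm_cinner_le)
      also have "\<dots> \<le> c * norm u * norm (S x)"
        using c[of "S a"] by (intro mult_right_mono) (auto simp: u')
      finally show ?thesis .
    qed
    have "subspace ?M"
      using linear_subspace_image[OF bounded_clinear_linear[OF R] subspace_UNIV]
      by (rule subspace_closure)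
    then obtain m where m: "m \<in> ?M" and orth: "\<And>n. n \<in> ?M \<Longrightarrow> Re (cinner n (x - m)) = 0"
      using orthogonal_decomposition_Re[of ?M x] by auto
    have Sxm: "S (x - m) = 0"
    proof -
      have "Re (cinner (?R (S (x - m))) (x - m)) = 0"
        by (rule orth) (meson closure_subset rangeI subsetD)
      then show ?thesis
        by (simp add: cinner_cadjoint_left[OF S] cinner_self_norm del: of_real_power)
    qed
    \<comment> \<open>\<open>x - m\<close> lies in the kernel of \<open>S\<close>, to which \<open>x\<close> is orthogonal, and is orthogonal to \<open>m\<close>.\<close>
    have "Re (cinner (x - m) (x - m)) = 0"
    proof -
      have "cinner (x - m) x = 0"
        by (rule x[OF Sxm])
      moreover have "Re (cinner (x - m) m) = 0"
        using orth[OF m] cinner_commute[of "x - m" m] by simp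
      ultimately show ?thesis
        by (simp add: cinner_diff_right)
    qed
    then have "x = m"
      by (simp add: cinner_self_norm del: of_real_power)
    then obtain u where u: "\<And>k. u k \<in> range ?R" and lim: "u \<longlonglongrightarrow> x"
      using m closure_sequential by metis
    have "(\<lambda>k. norm (cinner x (u k))) \<longlonglongrightarrow> norm (cinner x x)"
      by (intro tendsto_norm bounded_linear.tendsto[OF bounded_linear_cinner_right] lim)
    moreover have "(\<lambda>k. c * norm (u k) * norm (S x)) \<longlonglongrightarrow> c * norm x * norm (S x)"
      by (intro tendsto_intros lim)
    moreover have "norm (cinner x (u k)) \<le> c * norm (u k) * norm (S x)" for k
      using estimate[OF u] by (metis cinner_commute complex_mod_cnj)
    ultimately have "norm (cinner x x) \<le> c * norm x * norm (S x)"
      using LIMSEQ_le by blast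
    then have "norm x * norm x \<le> norm x * (c * norm (S x))"
      by (simp add: cinner_self_norm norm_power power2_eq_square norm_mult mult_ac)
    then show ?thesis
      using \<open>c \<ge> 0\<close> by (cases "x = 0") auto
  qed
  with \<open>c \<ge> 0\<close> show ?thesis
    by blast
qed

section \<open>The Moore-Penrose inverse\<close>

lemma mp_inverse_exists:
  assumes S: "bounded_clinear S" and "closed (range S)"
  shows "\<exists>X. is_mp_inverse S X"
proof -
  \<comment> \<open>\<open>sol y x\<close>: \<open>x\<close> is the least-squares solution of \<open>S x = y\<close> that is orthogonal to the kernel.
    The condition is linear in the pair, so uniqueness makes the solution map linear.\<close>
  define sol where "sol y x \<longleftrightarrow>
    (\<forall>z. cinner (S z) (y - S x) = 0) \<and> (\<forall>z. S z = 0 \<longrightarrow> cinner z x = 0)" for y x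
  have "\<exists>x. sol y x" for y
  proof -
    obtain x where x: "\<And>z. cinner (S z) (y - S x) = 0"
      using range_decomposition[OF assms] by blast
    obtain n where n: "S n = 0" "\<And>z. S z = 0 \<Longrightarrow> cinner z (x - n) = 0"
      using kernel_decomposition[OF S] by blast
    have "sol y (x - n)"
      using x n by (simp add: sol_def bounded_clinear_diff[OF S])
    then show ?thesis ..
  qed
  then obtain X where X: "\<And>y. sol y (X y)"
    by metis
  have sol_unique: "x = x'" if "sol y x" "sol y x'" for y x x'
  proof -
    have "cinner (S z) (S x - S x') = 0" for z
    proof -
      have "cinner (S z) (y - S x) = 0" "cinner (S z) (y - S x') = 0"
        using that by (auto simp: sol_def)
      then show ?thesis
        by (simp add: cinner_diff_right)
    qed
    from this[of "x - x'"] have "S (x - x') = 0"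
      by (simp add: bounded_clinear_diff[OF S, symmetric])
    then have "cinner (x - x') (x - x') = 0"
      using that by (simp add: sol_def cinner_diff_right)
    then show ?thesis
      by simp
  qed
  obtain c where "c \<ge> 0" and c: "\<And>x. (\<forall>z. S z = 0 \<longrightarrow> cinner z x = 0) \<Longrightarrow> norm x \<le> c * norm (S x)"
    using bounded_below_on_kernel_complement[OF assms] by blast
  have orth: "cinner (S z) (y - S (X y)) = 0" for y z
    using X by (simp add: sol_def)
  have bX: "bounded_clinear X"
  proof (rule bounded_clinearI)
    show "X (y + y') = X y + X y'" for y y'
    proof (rule sol_unique[OF X])
      have "y + y' - (S (X y) + S (X y')) = (y - S (X y)) + (y' - S (X y'))"
        by simp
      then show "sol (y + y') (X y + X y')"
        using X[of y] X[of y'] by (simp only: sol_def bounded_clinear_add[OF S] cinner_add_right) simp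
    qed
    show "X (a *\<^sub>C y) = a *\<^sub>C X y" for a y
    proof (rule sol_unique[OF X])
      show "sol (a *\<^sub>C y) (a *\<^sub>C X y)"
        using X[of y]
        by (simp add: sol_def bounded_clinear_scaleC[OF S] cinner_scaleC_right
            scaleC_diff_right[symmetric])
    qed
    show "norm (X y) \<le> norm y * c" for y
    proof -
      have "cinner (S (X y)) y = cinner (S (X y)) (S (X y))"
        using orth[of "X y" y] by (simp add: cinner_diff_right)
      then have "(norm (S (X y)))\<^sup>2 = norm (cinner (S (X y)) y)"
        by (simp add: cinner_self_norm norm_power)
      also have "\<dots> \<le> norm (S (X y)) * norm y"
        by (rule norm_cinner_le)
      finally have "norm (S (X y)) \<le> norm y"
        by (cases "S (X y) = 0") (auto simp: power2_eq_square)
      then have "c * norm (S (X y)) \<le> c * norm y"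
        using \<open>c \<ge> 0\<close> by (rule mult_left_mono)
      moreover have "norm (X y) \<le> c * norm (S (X y))"
        using X[of y] by (intro c) (simp add: sol_def)
      ultimately show ?thesis
        by (simp add: mult.commute)
    qed
  qed
  have SXS: "S (X (S x)) = S x" for x
  proof -
    have "cinner (S x - S (X (S x))) (S x - S (X (S x))) = 0"
      using orth[of "x - X (S x)" "S x"] by (simp add: bounded_clinear_diff[OF S])
    then show ?thesis
      by simp
  qed
  have XSX: "X (S (X y)) = X y" for y
    by (rule sol_unique[OF X]) (use X[of y] in \<open>simp add: sol_def\<close>)
  have "cadjoint (S \<circ> X) = S \<circ> X"
  proof (rule cadjoint_eqI)
    show "bounded_clinear (S \<circ> X)"
      by (intro bounded_clinear_compose S bX)
    have proj: "cinner (S (X y)) z = cinner (S (X y)) (S (X z))" for y z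
      using orth[of "X y" z] by (simp add: cinner_diff_right)
    show "cinner ((S \<circ> X) y) z = cinner y ((S \<circ> X) z)" for y z
      by (metis proj cinner_commute comp_apply)
  qed
  moreover have "cadjoint (X \<circ> S) = X \<circ> S"
  proof (rule cadjoint_eqI)
    show "bounded_clinear (X \<circ> S)"
      by (intro bounded_clinear_compose S bX)
    have proj: "cinner x (X (S z)) = cinner (X (S x)) (X (S z))" for x z
    proof -
      have "S (x - X (S x)) = 0"
        by (simp add: bounded_clinear_diff[OF S] SXS)
      then have "cinner (x - X (S x)) (X (S z)) = 0"
        using X[of "S z"] by (simp add: sol_def)
      then show ?thesis
        by (simp add: cinner_diff_left)
    qed
    show "cinner ((X \<circ> S) x) z = cinner x ((X \<circ> S) z)" for x z
      by (metis proj cinner_commute comp_apply)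
  qed
  ultimately have "is_mp_inverse S X"
    using bX SXS XSX by (auto simp: is_mp_inverse_def)
  then show ?thesis
    by blast
qed

lemma mp_inverse_selfadjoint:
  assumes S: "bounded_clinear S" and X: "is_mp_inverse S X"
  shows "cinner (S (X y)) z = cinner y (S (X z))" and "cinner (X (S x)) w = cinner x (X (S w))"
proof -
  have "bounded_clinear (S \<circ> X)" "bounded_clinear (X \<circ> S)"
    using assms by (auto simp: is_mp_inverse_def intro: bounded_clinear_compose)
  from cinner_cadjoint[OF this(1)] cinner_cadjoint[OF this(2)]
  show "cinner (S (X y)) z = cinner y (S (X z))" "cinner (X (S x)) w = cinner x (X (S w))"
    using X by (auto simp: is_mp_inverse_def)
qed

text \<open>The two conditions are adjoint to each other: \<open>P \<circ> Q = Q\<close> and \<open>Q \<circ> P = Q\<close>.\<close>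

lemma selfadjoint_absorb_iff:
  fixes P Q :: "'a::complex_inner \<Rightarrow> 'a"
  assumes P: "\<And>x y. cinner (P x) y = cinner x (P y)"
    and Q: "\<And>x y. cinner (Q x) y = cinner x (Q y)"
  shows "(\<forall>x. P (Q x) = Q x) \<longleftrightarrow> (\<forall>x. Q (P x) = Q x)"
proof (intro iffI allI)
  fix x assume absorb: "\<forall>x. P (Q x) = Q x"
  have "cinner z (Q (P x)) = cinner z (Q x)" for z
    using absorb by (simp only: P[symmetric] Q[symmetric])
  then show "Q (P x) = Q x"
    by (rule cinner_ext)
next
  fix x assume absorb: "\<forall>x. Q (P x) = Q x"
  have "cinner z (P (Q x)) = cinner z (Q x)" for z
    using absorb by (simp only: P[symmetric] Q[symmetric])
  then show "P (Q x) = Q x"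
    by (rule cinner_ext)
qed

lemma is_mp_inverse_unique:
  assumes S: "bounded_clinear S" and X: "is_mp_inverse S X" and Y: "is_mp_inverse S Y"
  shows "X = Y"
proof
  fix y
  have X_simps: "S (X (S x)) = S x" "X (S (X y)) = X y" for x y
    using X by (auto simp: is_mp_inverse_def fun_eq_iff)
  have Y_simps: "S (Y (S x)) = S x" "Y (S (Y y)) = Y y" for x y
    using Y by (auto simp: is_mp_inverse_def fun_eq_iff)
  note sa = mp_inverse_selfadjoint[OF S X] mp_inverse_selfadjoint[OF S Y]
  \<comment> \<open>\<open>S \<circ> X\<close> and \<open>S \<circ> Y\<close> absorb each other on the left, hence also on the right, and so agree;
    likewise \<open>X \<circ> S\<close> and \<open>Y \<circ> S\<close>, with left and right exchanged.\<close>
  have "S (Y (S (X y))) = S (Y y)"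
    using selfadjoint_absorb_iff[of "\<lambda>y. S (X y)" "\<lambda>y. S (Y y)", OF sa(1,3)] X_simps(1) by blast
  then have SX: "S (X y) = S (Y y)"
    by (simp add: Y_simps)
  have "Y (S (X (S x))) = X (S x)" for x
    using selfadjoint_absorb_iff[of "\<lambda>x. Y (S x)" "\<lambda>x. X (S x)", OF sa(4,2)] Y_simps(1) by simp
  then have XS: "X (S x) = Y (S x)" for x
    by (simp add: X_simps)
  have "X y = X (S (Y y))"
    by (simp add: X_simps flip: SX)
  also have "\<dots> = Y y"
    by (simp add: XS Y_simps)
  finally show "X y = Y y" .
qed

lemma is_mp_inverse_mp_inverse:
  assumes "bounded_clinear S" and "closed (range S)"
  shows "is_mp_inverse S (mp_inverse S)"
  unfolding mp_inverse_def
proof (rule theI'[of "is_mp_inverse S"])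
  show "\<exists>!X. is_mp_inverse S X"
    using mp_inverse_exists[OF assms] is_mp_inverse_unique[OF assms(1)] by blast
qed

lemma kernel_comp_mp_inverse:
  assumes S: "bounded_clinear S" and X: "is_mp_inverse S X"
  shows "kernel (S \<circ> X) = kernel (cadjoint S)" and "kernel (X \<circ> S) = kernel S"
proof -
  have SXS: "S (X (S x)) = S x" for x
    using X by (auto simp: is_mp_inverse_def fun_eq_iff)
  have X0: "X 0 = 0"
    using X by (auto simp: is_mp_inverse_def bounded_clinear_0)
  note sa = mp_inverse_selfadjoint[OF assms]
  have "S (X y) = 0 \<longleftrightarrow> (\<forall>x. cinner (S x) y = 0)" for y
  proof
    assume "S (X y) = 0"
    then show "\<forall>x. cinner (S x) y = 0"
      using sa(1)[of "S _" y] by (simp add: SXS)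
  next
    assume "\<forall>x. cinner (S x) y = 0"
    then have "cinner z (S (X y)) = cinner z 0" for z
      by (simp add: sa(1)[symmetric])
    then show "S (X y) = 0"
      by (rule cinner_ext)
  qed
  then show "kernel (S \<circ> X) = kernel (cadjoint S)"
    unfolding kernel_cadjoint[OF S] by (simp add: kernel_def)
  show "kernel (X \<circ> S) = kernel S"
  proof -
    have "X (S x) = 0 \<longleftrightarrow> S x = 0" for x
      using X0 SXS[of x] bounded_clinear_0[OF S] by auto
    then show ?thesis
      by (simp add: kernel_def)
  qed
qed

lemma selfadjoint_idempotent_eq:
  fixes P Q :: "'a::complex_inner \<Rightarrow> 'a"
  assumes "\<And>x y. P (x - y) = P x - P y" and "\<And>x y. Q (x - y) = Q x - Q y"
    and "\<And>x y. cinner (P x) y = cinner x (P y)" and "\<And>x y. cinner (Q x) y = cinner x (Q y)"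
    and "\<And>x. P (P x) = P x" and "\<And>x. Q (Q x) = Q x"
    and "kernel P = kernel Q"
  shows "P = Q"
proof
  fix x
  have ker: "P x = 0 \<longleftrightarrow> Q x = 0" for x
    using assms(7) by (auto simp: kernel_def set_eq_iff)
  \<comment> \<open>\<open>x - P x\<close> lies in the kernel of \<open>P\<close>, hence in that of \<open>Q\<close>; and conversely.\<close>
  have QP: "Q (P x) = Q x" for x
    using ker[of "x - P x"] assms(1,2,5) by simp
  have PQ: "P (Q x) = P x" for x
    using ker[of "x - Q x"] assms(1,2,6) by simp
  have "P (Q x) = Q x"
    using selfadjoint_absorb_iff[of P Q, OF assms(3,4)] QP by blast
  then show "P x = Q x"
    by (simp add: PQ)
qed

section \<open>EP operators and full rank factorizations\<close>

theorem theorem5p1: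
  fixes T :: "'h::complex_hilbert_space \<Rightarrow> 'h"
    and B :: "'k::complex_hilbert_space \<Rightarrow> 'h"
    and C :: "'h \<Rightarrow> 'k"
  assumes "bounded_clinear T" and "closed (range T)"
    and "bounded_clinear B" and "inj B" and "closed (range B)"
    and "bounded_clinear C" and "surj C"
    and "T = B \<circ> C"
  shows "(EP T \<longleftrightarrow> B \<circ> mp_inverse B = mp_inverse C \<circ> C) \<and>
         (B \<circ> mp_inverse B = mp_inverse C \<circ> C \<longleftrightarrow> kernel (cadjoint B) = kernel C)"
proof -
  note T = assms(1) and B = assms(3) and C = assms(6)
  have "closed (range C)"
    using assms(7) by simp
  note mpB = is_mp_inverse_mp_inverse[OF B assms(5)]
    and mpC = is_mp_inverse_mp_inverse[OF C this]
  have "range T = range B"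
    unfolding assms(8) image_comp[symmetric] assms(7) ..
  then have "kernel (cadjoint T) = kernel (cadjoint B)"
    by (simp only: kernel_cadjoint[OF T] kernel_cadjoint[OF B])
  moreover have "kernel T = kernel C"
    using inj_eq[OF assms(4), of _ 0] by (simp add: assms(8) kernel_def bounded_clinear_0[OF B])
  ultimately have EP_iff: "EP T \<longleftrightarrow> kernel (cadjoint B) = kernel C"
    using T assms(2) by (auto simp: EP_def)
  have "B \<circ> mp_inverse B = mp_inverse C \<circ> C" if "kernel (cadjoint B) = kernel C"
  proof (rule selfadjoint_idempotent_eq)
    have "bounded_clinear (B \<circ> mp_inverse B)" "bounded_clinear (mp_inverse C \<circ> C)"
      using mpB mpC B C by (auto simp: is_mp_inverse_def intro: bounded_clinear_compose)
    note diff = this[THEN bounded_clinear_diff]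
    show "(B \<circ> mp_inverse B) (x - y) = (B \<circ> mp_inverse B) x - (B \<circ> mp_inverse B) y" for x y
      by (rule diff)
    show "(mp_inverse C \<circ> C) (x - y) = (mp_inverse C \<circ> C) x - (mp_inverse C \<circ> C) y" for x y
      by (rule diff)
    show "kernel (B \<circ> mp_inverse B) = kernel (mp_inverse C \<circ> C)"
      using that kernel_comp_mp_inverse[OF B mpB] kernel_comp_mp_inverse[OF C mpC] by simp
  qed (use mpB mpC mp_inverse_selfadjoint[OF B mpB] mp_inverse_selfadjoint[OF C mpC]
      in \<open>auto simp: is_mp_inverse_def fun_eq_iff\<close>)
  moreover have "kernel (cadjoint B) = kernel C" if "B \<circ> mp_inverse B = mp_inverse C \<circ> C"
    using that kernel_comp_mp_inverse(1)[OF B mpB] kernel_comp_mp_inverse(2)[OF C mpC] by simp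
  ultimately show ?thesis
    using EP_iff by blast
qed

end
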